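(* Let $(\mathbf{u}_k)_{0\le k\le n}$ be defined by $\mathbf{u}_n=F_n$ and $$\mathbf{u}_k(x_0,\dots,x_k)=F_k(x_0,\dots,x_k)\vee\int M_{k+1}(x_k,dx_{k+1})\,\mathbf{u}_{k+1}(x_0,\dots,x_k,x_{k+1}),\qquad 0\le k\le n-1,$$ where $F_k(x_0,\dots,x_k):=f_k(x_k)\prod_{p=0}^{k-1}G_p(x_p)$, and let $(v_k)_{0\le k\le n}$ be defined by $v_n=f_n$ and $$v_k(x_k)=f_k(x_k)\vee\big[G_k(x_k)\,M_{k+1}(v_{k+1})(x_k)\big],\qquad 0\le k\le n-1.$$ Then for all $0\le k\le n$ and all $(x_0,\dots,x_k)\in E_0\times\cdots\times E_k$, $$\mathbf{u}_k(x_0,\dots,x_k)=v_k(x_k)\prod_{p=0}^{k-1}G_p(x_p);$$ in particular $\mathbf{u}_0(x_0)=v_0(x_0)$.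
   Context: $(E_k,\mathcal{E}_k)_{0\le k\le n}$ are measurable spaces, $M_k(x_{k-1},dx_k)$ are Markov transitions from $E_{k-1}$ to $E_k$ ($1\le k\le n$), $M_k(f)(x_{k-1})=\int M_k(x_{k-1},dx_k)f(x_k)$, $f_k:E_k\to[0,\infty)$ and $G_k:E_k\to[0,\infty)$ are measurable, and the functions $v_k$ are assumed finite everywhere. $\vee$ denotes the maximum; empty products equal $1$. ($\mathbf{u}_k$ is the Snell envelope on path space of the Markov chain with transitions $M_k$ for the gains $F_k$.) *)

theory Defs
  imports "HOL-Probability.Probability"
begin

text \<open>
  The state spaces are a family \<open>E\<close> of measurable spaces over one type, with arbitrary carriers
  \<open>space (E k)\<close>; only the \<open>\<sigma>\<close>-algebra of \<open>E k\<close> matters. The kernel \<open>M k\<close> leads from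
  \<open>E (k - 1)\<close> to \<open>E k\<close>. A path \<open>(x\<^sub>0, \<dots>, x\<^sub>k)\<close> is an element of
  \<open>\<Pi>\<^sub>E i\<in>{..k}. space (E i)\<close>, and \<open>x(Suc k := y)\<close> is that path prolonged by \<open>y\<close>.
  As the gains are nonnegative, the integrals are taken in \<open>[0, \<infinity>]\<close>.
\<close>

definition kernel_op :: "('a \<Rightarrow> 'b measure) \<Rightarrow> ('b \<Rightarrow> ennreal) \<Rightarrow> 'a \<Rightarrow> ennreal" where
  "kernel_op K h x = (\<integral>\<^sup>+ y. h y \<partial>K x)"

definition path_gain ::
    "(nat \<Rightarrow> 'a \<Rightarrow> real) \<Rightarrow> (nat \<Rightarrow> 'a \<Rightarrow> real) \<Rightarrow> nat \<Rightarrow> (nat \<Rightarrow> 'a) \<Rightarrow> real" where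
  "path_gain f G k x = f k (x k) * (\<Prod>p<k. G p (x p))"

text \<open>
  The backward recursions from the horizon \<open>n\<close>; the values at times \<open>k > n\<close> are irrelevant.
\<close>

function path_snell ::
    "nat \<Rightarrow> (nat \<Rightarrow> 'a \<Rightarrow> 'a measure) \<Rightarrow> (nat \<Rightarrow> (nat \<Rightarrow> 'a) \<Rightarrow> real) \<Rightarrow>
      nat \<Rightarrow> (nat \<Rightarrow> 'a) \<Rightarrow> ennreal" where
  "path_snell n M F k x =
    (if k < n
     then max (ennreal (F k x)) (\<integral>\<^sup>+ y. path_snell n M F (Suc k) (x(Suc k := y)) \<partial>M (Suc k) (x k))
     else ennreal (F k x))"
  by pat_completeness auto
termination
  by (relation "Wellfounded.measure (\<lambda>(n, _, _, k, _). n - k)") auto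

function state_snell ::
    "nat \<Rightarrow> (nat \<Rightarrow> 'a \<Rightarrow> 'a measure) \<Rightarrow> (nat \<Rightarrow> 'a \<Rightarrow> real) \<Rightarrow> (nat \<Rightarrow> 'a \<Rightarrow> real) \<Rightarrow>
      nat \<Rightarrow> 'a \<Rightarrow> ennreal" where
  "state_snell n M f G k x =
    (if k < n
     then max (ennreal (f k x))
       (ennreal (G k x) * kernel_op (M (Suc k)) (\<lambda>y. state_snell n M f G (Suc k) y) x)
     else ennreal (f k x))"
  by pat_completeness auto
termination
  by (relation "Wellfounded.measure (\<lambda>(n, _, _, _, k, _). n - k)") auto

declare path_snell.simps [simp del] state_snell.simps [simp del]

lemma path_snell_terminal: "path_snell n M F n x = ennreal (F n x)"
  by (simp add: path_snell.simps)

lemma path_snell_step: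
  "k < n \<Longrightarrow> path_snell n M F k x =
    max (ennreal (F k x)) (\<integral>\<^sup>+ y. path_snell n M F (Suc k) (x(Suc k := y)) \<partial>M (Suc k) (x k))"
  by (subst path_snell.simps) simp

lemma state_snell_terminal: "state_snell n M f G n x = ennreal (f n x)"
  by (simp add: state_snell.simps)

lemma state_snell_step:
  "k < n \<Longrightarrow> state_snell n M f G k x =
    max (ennreal (f k x))
      (ennreal (G k x) * kernel_op (M (Suc k)) (state_snell n M f G (Suc k)) x)"
  by (subst state_snell.simps) simp

end

theory Submission
  imports Defs
begin

text \<open>
  Backward induction: the weight \<open>\<Prod>p<Suc k. G p (x p)\<close> does not depend on the new point
  \<open>x (Suc k)\<close>, so it comes out of the integral over that point, and as it is nonnegative it also
  comes out of the maximum.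
\<close>

text \<open>A Markov kernel is in particular a subprobability kernel, and integrating a nonnegative
  measurable function against such a kernel depends measurably on the starting point.\<close>

lemma measurable_kernel_op:
  assumes "K \<in> A \<rightarrow>\<^sub>M prob_algebra B" "h \<in> borel_measurable B"
  shows "kernel_op K h \<in> borel_measurable A"
  unfolding kernel_op_def
  by (rule measurable_compose[OF measurable_prob_algebraD[OF assms(1)]
        nn_integral_measurable_subprob_algebra[OF assms(2)]])

text \<open>Taking a constant factor out of a \<open>nn_integral\<close> requires a measurable
  integrand; in the backward induction for the paths that integrand is the state envelope at the
  next time.\<close>

lemma measurable_state_snell:
  assumes "\<And>k. 1 \<le> k \<Longrightarrow> k \<le> n \<Longrightarrow> M k \<in> E (k - 1) \<rightarrow>\<^sub>M prob_algebra (E k)"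
    and "\<And>k. k \<le> n \<Longrightarrow> f k \<in> borel_measurable (E k)"
    and "\<And>k. k \<le> n \<Longrightarrow> G k \<in> borel_measurable (E k)"
    and "k \<le> n"
  shows "state_snell n M f G k \<in> borel_measurable (E k)"
  using \<open>k \<le> n\<close>
proof (induction rule: inc_induct)
  case base
  have [measurable]: "f n \<in> borel_measurable (E n)" by (rule assms(2)) simp
  show ?case by (simp add: state_snell_terminal cong: measurable_cong)
next
  case (step k)
  have [measurable]: "f k \<in> borel_measurable (E k)" "G k \<in> borel_measurable (E k)"
    using step.hyps assms(2,3) by simp_all
  have [measurable]: "kernel_op (M (Suc k)) (state_snell n M f G (Suc k)) \<in> borel_measurable (E k)"
    using measurable_kernel_op[OF _ step.IH] assms(1)[of "Suc k"] step.hyps by simp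
  show ?case
    by (subst measurable_cong[OF state_snell_step[OF \<open>k < n\<close>]]) measurable
qed

lemma path_snell_eq_state_snell:
  assumes markov: "\<And>k. 1 \<le> k \<Longrightarrow> k \<le> n \<Longrightarrow> M k \<in> E (k - 1) \<rightarrow>\<^sub>M prob_algebra (E k)"
    and f_measurable: "\<And>k. k \<le> n \<Longrightarrow> f k \<in> borel_measurable (E k)"
    and G_measurable: "\<And>k. k \<le> n \<Longrightarrow> G k \<in> borel_measurable (E k)"
    and G_nonneg: "\<And>k x. k \<le> n \<Longrightarrow> x \<in> space (E k) \<Longrightarrow> 0 \<le> G k x"
    and "k \<le> n" and "\<And>i. i \<le> k \<Longrightarrow> x i \<in> space (E i)"
  shows "path_snell n M (path_gain f G) k x =
      state_snell n M f G k (x k) * ennreal (\<Prod>p<k. G p (x p))"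
  using \<open>k \<le> n\<close> assms(6)
\<comment> \<open>The path is generalised because the induction hypothesis is applied to
  \<open>x(Suc k := y)\<close> for every \<open>y\<close>.\<close>
proof (induction arbitrary: x rule: inc_induct)
  case base
  have "0 \<le> (\<Prod>p<n. G p (x p))"
    using base G_nonneg by (intro prod_nonneg) simp
  then show ?case
    by (simp add: path_snell_terminal state_snell_terminal path_gain_def ennreal_mult'')
next
  case (step k)
  let ?v = "state_snell n M f G (Suc k)" and ?K = "M (Suc k) (x k)"
  define P where "P = (\<Prod>p<k. G p (x p))"
  have P: "0 \<le> P"
    unfolding P_def using step.prems step.hyps G_nonneg by (intro prod_nonneg) simp
  have Gk: "0 \<le> G k (x k)"
    using step.prems step.hyps G_nonneg by simp
  have K: "M (Suc k) \<in> E k \<rightarrow>\<^sub>M prob_algebra (E (Suc k))"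
    using markov[of "Suc k"] step.hyps by simp
  \<comment> \<open>A value of the kernel lies in \<open>prob_algebra (E (Suc k))\<close>, so it
    carries the \<sigma>-algebra of \<open>E (Suc k)\<close>. This transfers measurability to
    \<open>?K\<close> and locates the integration variable.\<close>
  have sets_K: "sets ?K = sets (E (Suc k))"
    using measurable_space[OF K step.prems[OF order_refl]] by (simp add: space_prob_algebra)
  have "?v \<in> borel_measurable (E (Suc k))"
    using measurable_state_snell[where n = n and E = E] markov f_measurable G_measurable step.hyps
    by simp
  then have v: "?v \<in> borel_measurable ?K"
    by (simp add: measurable_cong_sets[OF sets_K refl])
  have "(\<integral>\<^sup>+ y. path_snell n M (path_gain f G) (Suc k) (x(Suc k := y)) \<partial>?K) =
      (\<integral>\<^sup>+ y. ?v y * ennreal (P * G k (x k)) \<partial>?K)"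
  \<comment> \<open>Equality is only needed for \<open>y\<close> in the carrier of
    \<open>?K\<close>, where the prolonged path stays in the state spaces.\<close>
  proof (rule nn_integral_cong)
    fix y assume "y \<in> space ?K"
    then have "y \<in> space (E (Suc k))"
      using sets_eq_imp_space_eq[OF sets_K] by simp
    then have "\<And>i. i \<le> Suc k \<Longrightarrow> (x(Suc k := y)) i \<in> space (E i)"
      using step.prems by (auto simp: le_Suc_eq)
    then have "path_snell n M (path_gain f G) (Suc k) (x(Suc k := y)) =
        ?v ((x(Suc k := y)) (Suc k)) * ennreal (\<Prod>p<Suc k. G p ((x(Suc k := y)) p))"
      by (rule step.IH)
    \<comment> \<open>The update leaves all coordinates \<open>p < Suc k\<close> unchanged; the
      factor for \<open>p = k\<close> splits off the product.\<close>
    then show "path_snell n M (path_gain f G) (Suc k) (x(Suc k := y)) = ?v y * ennreal (P * G k (x k))"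
      by (simp add: P_def)
  qed
  \<comment> \<open>The weight is divided: \<open>G k (x k)\<close> joins the integral to form the
    continuation term of \<open>state_snell\<close> at time \<open>k\<close>, and \<open>P\<close>
    remains as the weight of the path up to time \<open>k\<close>.\<close>
  also have "\<dots> = kernel_op (M (Suc k)) ?v (x k) * ennreal (P * G k (x k))"
    by (simp add: nn_integral_multc[OF v] kernel_op_def)
  also have "\<dots> = ennreal (G k (x k)) * kernel_op (M (Suc k)) ?v (x k) * ennreal P"
    using P Gk by (simp add: ennreal_mult mult_ac)
  finally have "path_snell n M (path_gain f G) k x =
      max (ennreal (f k (x k)) * ennreal P)
        (ennreal (G k (x k)) * kernel_op (M (Suc k)) ?v (x k) * ennreal P)"
    using P step.hyps by (simp add: path_snell_step path_gain_def P_def ennreal_mult'')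
  \<comment> \<open>Multiplication by \<open>ennreal P\<close> is monotone, and a monotone map
    between linear orders commutes with \<open>max\<close>.\<close>
  also have "\<dots> = state_snell n M f G k (x k) * ennreal P"
    using step.hyps
    by (simp add: state_snell_step max_of_mono[of "\<lambda>z. z * ennreal P"] mono_def mult_right_mono)
  finally show ?case
    by (simp add: P_def)
qed

theorem mainTheorem3:
  fixes n :: nat
    and E :: "nat \<Rightarrow> 'a measure"
    and M :: "nat \<Rightarrow> 'a \<Rightarrow> 'a measure"
    and f G :: "nat \<Rightarrow> 'a \<Rightarrow> real"
  assumes markov: "\<And>k. 1 \<le> k \<Longrightarrow> k \<le> n \<Longrightarrow> M k \<in> E (k - 1) \<rightarrow>\<^sub>M prob_algebra (E k)"
    and f_measurable: "\<And>k. k \<le> n \<Longrightarrow> f k \<in> borel_measurable (E k)"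
    and f_nonneg: "\<And>k x. k \<le> n \<Longrightarrow> x \<in> space (E k) \<Longrightarrow> 0 \<le> f k x"
    and G_measurable: "\<And>k. k \<le> n \<Longrightarrow> G k \<in> borel_measurable (E k)"
    and G_nonneg: "\<And>k x. k \<le> n \<Longrightarrow> x \<in> space (E k) \<Longrightarrow> 0 \<le> G k x"
    and v_finite: "\<And>k x. k \<le> n \<Longrightarrow> x \<in> space (E k) \<Longrightarrow> state_snell n M f G k x < \<infinity>"
  shows "(\<forall>k\<le>n. \<forall>x\<in>(\<Pi>\<^sub>E i\<in>{..k}. space (E i)).
            path_snell n M (path_gain f G) k x =
              state_snell n M f G k (x k) * ennreal (\<Prod>p<k. G p (x p)))
       \<and> (\<forall>x\<^sub>0\<in>space (E 0).
            path_snell n M (path_gain f G) 0 (\<lambda>i\<in>{..0}. x\<^sub>0) = state_snell n M f G 0 x\<^sub>0)"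
proof (intro conjI allI impI ballI)
  show main: "path_snell n M (path_gain f G) k x =
      state_snell n M f G k (x k) * ennreal (\<Prod>p<k. G p (x p))"
    if "k \<le> n" "x \<in> (\<Pi>\<^sub>E i\<in>{..k}. space (E i))" for k x
    using path_snell_eq_state_snell[where n = n and E = E and M = M and f = f and G = G,
        OF markov f_measurable G_measurable G_nonneg] that by auto
  show "path_snell n M (path_gain f G) 0 (\<lambda>i\<in>{..0}. x\<^sub>0) = state_snell n M f G 0 x\<^sub>0"
    if "x\<^sub>0 \<in> space (E 0)" for x\<^sub>0
    \<comment> \<open>The restricted constant function is the one-point path, and the product over
      \<open>p < 0\<close> is empty.\<close>
    using main[of 0 "\<lambda>i\<in>{..0}. x\<^sub>0"] that by auto
qed

end
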